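(* For every $s\in\mathbb{C}$ with $\mathrm{Re}(s)\ge0$ such that $a^ns\notin\{\lambda_1,\ldots,\lambda_N\}$ for all $n\ge0$, $$\tilde Z(s)=s\sum_{n=0}^\infty a^n\prod_{m=0}^{n-1}H(a^ms)\,F(a^ns)\,\tilde v+\prod_{m=0}^\infty H(a^ms)\,\tilde\pi,\qquad \tilde Z(0)=\tilde\pi .$$
   Context: Let $E=\{1,\ldots,N\}$, $a\in(0,1)$. $(Y_n)_{n\ge0}$ is an irreducible discrete-time Markov chain on $E$ with transition matrix $P=(p_{i,j})$ and stationary distribution $\tilde\pi=(\pi_1,\ldots,\pi_N)^T$. The nonnegative process $W_n$ (workload just before the $n$th arrival) satisfies $W_{n+1}=[aW_n+S_n-A_{n+1}]^+$, where $[x]^+=\max(0,x)$ and $S_n,A_{n+1}\ge0$. Given $Y_n$, the triple $(A_{n+1},S_n,Y_{n+1})$ is independent of the past (in particular of $W_n$), and for $x,y\ge0$ $$P(A_{n+1}\le x,S_n\le y,Y_{n+1}=j\mid Y_n=i)=p_{i,j}F_{S,i}(y)(1-e^{-\lambda_jx}),$$ where $F_{S,i}$ is a distribution function on $[0,\infty)$ and $\lambda_j>0$. Notation: $\beta_i^*(s)=\int_0^\infty e^{-st}dF_{S,i}(t)$, $B^*(s)=\mathrm{diag}(\beta_1^*(s),\ldots,\beta_N^*(s))$, $\Lambda=\mathrm{diag}(\lambda_1,\ldots,\lambda_N)$, $L(s)=\mathrm{diag}\big(\frac{\lambda_1}{\lambda_1-s},\ldots,\frac{\lambda_N}{\lambda_N-s}\big)$,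 $H(s)=L(s)P^TB^*(s)$, $F(s)=-\Lambda^{-1}L(s)$. For $\mathrm{Re}(s)\ge0$, $Z_i(s)=\lim_{n\to\infty}E(e^{-sW_n}1_{\{Y_n=i\}})$; it is assumed that these limits exist and are the transforms $E(e^{-sW}1_{\{Y=i\}})$ of a steady-state pair $(W,Y)$ with $W$ finite and $P(Y=i)=\pi_i$. $\tilde Z(s)=(Z_1(s),\ldots,Z_N(s))^T$, and $\tilde v=(v_1,\ldots,v_N)^T$ with $v_j=\sum_{i=1}^Np_{i,j}\beta_i^*(\lambda_j)Z_i(a\lambda_j)$. Matrix products are ordered with increasing index from left to right, empty products are the identity, and $\prod_{m=0}^\infty H(a^ms)\tilde\pi$ means $\lim_{n\to\infty}\prod_{m=0}^{n}H(a^ms)\tilde\pi$. *)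

theory Defs
  imports "HOL-Probability.Probability"
begin

section \<open>Finite Markov chains\<close>

text \<open>The state space is an arbitrary finite type \<open>'n\<close>, playing the role of \<open>{1, ..., N}\<close>.\<close>

definition stochastic_matrix :: "real^'n^'n \<Rightarrow> bool" where
  "stochastic_matrix P \<longleftrightarrow> (\<forall>i j. 0 \<le> P $ i $ j) \<and> (\<forall>i. (\<Sum>j\<in>UNIV. P $ i $ j) = 1)"

definition irreducible_matrix :: "real^'n^'n \<Rightarrow> bool" where
  "irreducible_matrix P \<longleftrightarrow> (\<forall>i j. \<exists>n. 0 < (((**) P ^^ n) (mat 1)) $ i $ j)"

definition stationary_distribution :: "real^'n^'n \<Rightarrow> real^'n \<Rightarrow> bool" where
  "stationary_distribution P \<pi> \<longleftrightarrow>
     (\<forall>i. 0 \<le> \<pi> $ i) \<and> (\<Sum>i\<in>UNIV. \<pi> $ i) = 1 \<and> \<pi> v* P = \<pi>"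

definition markov_chain :: "'w measure \<Rightarrow> real^'n^'n \<Rightarrow> (nat \<Rightarrow> 'w \<Rightarrow> 'n) \<Rightarrow> bool" where
  "markov_chain M P Y \<longleftrightarrow>
     (\<forall>n. Y n \<in> measurable M (count_space UNIV)) \<and>
     (\<forall>n (y :: nat \<Rightarrow> 'n). \<P>(\<omega> in M. \<forall>k\<le>n. Y k \<omega> = y k) > 0 \<longrightarrow>
        \<P>(\<omega> in M. Y (Suc n) \<omega> = y (Suc n) \<bar> \<forall>k\<le>n. Y k \<omega> = y k) = P $ y n $ y (Suc n))"

section \<open>The driving sequence\<close>

text \<open>Distribution functions on \<open>[0,\<infinity>)\<close>, extended by \<open>0\<close> to the negative half-line; an atom at
  \<open>0\<close> is allowed.\<close>

definition distribution_function_nonneg :: "(real \<Rightarrow> real) \<Rightarrow> bool" where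
  "distribution_function_nonneg G \<longleftrightarrow>
     mono G \<and> (\<forall>x. continuous (at_right x) G) \<and> (\<forall>x<0. G x = 0) \<and> (G \<longlongrightarrow> 1) at_top"

text \<open>The events generated by \<open>Y\<^sub>0, ..., Y\<^sub>n\<close>, \<open>W\<^sub>0, ..., W\<^sub>n\<close>, \<open>A\<^sub>1, ..., A\<^sub>n\<close> and
  \<open>S\<^sub>0, ..., S\<^sub>n\<^sub>-\<^sub>1\<close>.\<close>

definition past_events ::
  "'w measure \<Rightarrow> (nat \<Rightarrow> 'w \<Rightarrow> 'n) \<Rightarrow> (nat \<Rightarrow> 'w \<Rightarrow> real) \<Rightarrow> (nat \<Rightarrow> 'w \<Rightarrow> real) \<Rightarrow>
    (nat \<Rightarrow> 'w \<Rightarrow> real) \<Rightarrow> nat \<Rightarrow> 'w set set" where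
  "past_events M Y W A S n = sigma_sets (space M)
     ({Y k -` B \<inter> space M | k B. k \<le> n} \<union>
      {W k -` B \<inter> space M | k B. k \<le> n \<and> B \<in> sets borel} \<union>
      {A k -` B \<inter> space M | k B. 1 \<le> k \<and> k \<le> n \<and> B \<in> sets borel} \<union>
      {S k -` B \<inter> space M | k B. k < n \<and> B \<in> sets borel})"

text \<open>Conditionally on \<open>Y\<^sub>n\<close>, the triple \<open>(A\<^sub>n\<^sub>+\<^sub>1, S\<^sub>n, Y\<^sub>n\<^sub>+\<^sub>1)\<close> is independent of the past.\<close>

definition conditionally_independent_of_past ::
  "'w measure \<Rightarrow> (nat \<Rightarrow> 'w \<Rightarrow> 'n) \<Rightarrow> (nat \<Rightarrow> 'w \<Rightarrow> real) \<Rightarrow> (nat \<Rightarrow> 'w \<Rightarrow> real) \<Rightarrow>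
    (nat \<Rightarrow> 'w \<Rightarrow> real) \<Rightarrow> bool" where
  "conditionally_independent_of_past M Y W A S \<longleftrightarrow>
     (\<forall>n i. \<forall>G \<in> past_events M Y W A S n.
        \<forall>D \<in> sets (borel \<Otimes>\<^sub>M borel \<Otimes>\<^sub>M count_space UNIV).
        \<P>(\<omega> in M. Y n \<omega> = i) > 0 \<longrightarrow>
        \<P>(\<omega> in M. ((A (Suc n) \<omega>, S n \<omega>, Y (Suc n) \<omega>) \<in> D \<and> \<omega> \<in> G) \<bar> Y n \<omega> = i) =
        \<P>(\<omega> in M. (A (Suc n) \<omega>, S n \<omega>, Y (Suc n) \<omega>) \<in> D \<bar> Y n \<omega> = i) *
        \<P>(\<omega> in M. \<omega> \<in> G \<bar> Y n \<omega> = i))"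

definition conditional_triple_law ::
  "'w measure \<Rightarrow> real^'n^'n \<Rightarrow> ('n \<Rightarrow> real) \<Rightarrow> ('n \<Rightarrow> real \<Rightarrow> real) \<Rightarrow>
    (nat \<Rightarrow> 'w \<Rightarrow> 'n) \<Rightarrow> (nat \<Rightarrow> 'w \<Rightarrow> real) \<Rightarrow> (nat \<Rightarrow> 'w \<Rightarrow> real) \<Rightarrow> bool" where
  "conditional_triple_law M P lam FS Y A S \<longleftrightarrow>
     (\<forall>n i j x y. 0 \<le> x \<longrightarrow> 0 \<le> y \<longrightarrow> \<P>(\<omega> in M. Y n \<omega> = i) > 0 \<longrightarrow>
        \<P>(\<omega> in M. (A (Suc n) \<omega> \<le> x \<and> S n \<omega> \<le> y \<and> Y (Suc n) \<omega> = j) \<bar> Y n \<omega> = i) =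
        P $ i $ j * FS i y * (1 - exp (- (lam j * x))))"

section \<open>Transforms\<close>

text \<open>The Lebesgue--Stieltjes integral of \<open>exp (- s t)\<close> against \<open>dG(t)\<close> over \<open>[0,\<infinity>)\<close>, including
  the atom at \<open>0\<close>.\<close>

definition LST :: "(real \<Rightarrow> real) \<Rightarrow> complex \<Rightarrow> complex" where
  "LST G s = (LINT t:{0..}|interval_measure G. exp (- (s * complex_of_real t)))"

definition joint_transform ::
  "'w measure \<Rightarrow> ('w \<Rightarrow> real) \<Rightarrow> ('w \<Rightarrow> 'n) \<Rightarrow> complex \<Rightarrow> 'n \<Rightarrow> complex" where
  "joint_transform M V X s i =
     (LINT \<omega>|M. exp (- (s * complex_of_real (V \<omega>))) * indicator {\<omega>. X \<omega> = i} \<omega>)"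

definition Z_vec ::
  "'w measure \<Rightarrow> (nat \<Rightarrow> 'w \<Rightarrow> real) \<Rightarrow> (nat \<Rightarrow> 'w \<Rightarrow> 'n::finite) \<Rightarrow> complex \<Rightarrow> complex^'n" where
  "Z_vec M W Y s = (\<chi> i. lim (\<lambda>n. joint_transform M (W n) (Y n) s i))"

definition is_steady_state ::
  "'w measure \<Rightarrow> (nat \<Rightarrow> 'w \<Rightarrow> real) \<Rightarrow> (nat \<Rightarrow> 'w \<Rightarrow> 'n::finite) \<Rightarrow> real^'n \<Rightarrow>
    'v measure \<Rightarrow> ('v \<Rightarrow> real) \<Rightarrow> ('v \<Rightarrow> 'n) \<Rightarrow> bool" where
  "is_steady_state M W Y \<pi> M' V X \<longleftrightarrow>
     prob_space M' \<and> V \<in> borel_measurable M' \<and> X \<in> measurable M' (count_space UNIV) \<and>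
     (\<forall>\<omega>\<in>space M'. 0 \<le> V \<omega>) \<and>
     (\<forall>i. \<P>(\<omega> in M'. X \<omega> = i) = \<pi> $ i) \<and>
     (\<forall>s i. 0 \<le> Re s \<longrightarrow>
        (\<lambda>n. joint_transform M (W n) (Y n) s i) \<longlonglongrightarrow> joint_transform M' V X s i)"

section \<open>The matrices of the functional equation\<close>

definition diag :: "('n \<Rightarrow> complex) \<Rightarrow> complex^'n^'n" where
  "diag d = (\<chi> i j. if i = j then d i else 0)"

definition B_mat :: "('n \<Rightarrow> real \<Rightarrow> real) \<Rightarrow> complex \<Rightarrow> complex^'n^'n" where
  "B_mat FS s = diag (\<lambda>i. LST (FS i) s)"

definition Lam_mat :: "('n \<Rightarrow> real) \<Rightarrow> complex^'n^'n" where
  "Lam_mat lam = diag (\<lambda>i. complex_of_real (lam i))"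

definition L_mat :: "('n \<Rightarrow> real) \<Rightarrow> complex \<Rightarrow> complex^'n^'n" where
  "L_mat lam s = diag (\<lambda>i. complex_of_real (lam i) / (complex_of_real (lam i) - s))"

definition H_mat ::
  "real^'n^'n \<Rightarrow> ('n \<Rightarrow> real) \<Rightarrow> ('n \<Rightarrow> real \<Rightarrow> real) \<Rightarrow> complex \<Rightarrow> complex^'n^'n" where
  "H_mat P lam FS s = L_mat lam s ** transpose (map_matrix complex_of_real P) ** B_mat FS s"

definition F_mat :: "('n \<Rightarrow> real) \<Rightarrow> complex \<Rightarrow> complex^'n^'n" where
  "F_mat lam s = - (matrix_inv (Lam_mat lam) ** L_mat lam s)"

definition v_vec ::
  "real^'n^'n \<Rightarrow> ('n \<Rightarrow> real) \<Rightarrow> ('n \<Rightarrow> real \<Rightarrow> real) \<Rightarrow> real \<Rightarrow> (complex \<Rightarrow> complex^'n) \<Rightarrow>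
    complex^'n" where
  "v_vec P lam FS a Z = (\<chi> j. \<Sum>i\<in>UNIV. complex_of_real (P $ i $ j) *
     LST (FS i) (complex_of_real (lam j)) * Z (complex_of_real (a * lam j)) $ i)"

text \<open>\<open>mat_prod Q n\<close> is \<open>Q 0 ** Q 1 ** ... ** Q (n - 1)\<close>.\<close>

primrec mat_prod :: "(nat \<Rightarrow> complex^'n^'n) \<Rightarrow> nat \<Rightarrow> complex^'n^'n" where
  "mat_prod Q 0 = mat 1"
| "mat_prod Q (Suc n) = mat_prod Q n ** Q n"

definition complex_vec :: "real^'n \<Rightarrow> complex^'n" where
  "complex_vec x = (\<chi> i. complex_of_real (x $ i))"

end

theory Submission
  imports Defs
begin

text \<open>The transform vector satisfies a functional equation that links its values at \<open>s\<close> and at \<open>a s\<close>,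
and the theorem is what remains after iterating that equation infinitely often.

The functional equation comes from one step of the workload recursion. Fix \<open>Y\<^sub>n = i\<close> and
\<open>Y\<^sub>n\<^sub>+\<^sub>1 = j\<close>. On this event the joint law of \<open>(W\<^sub>n, S\<^sub>n, A\<^sub>n\<^sub>+\<^sub>1)\<close> is, up to the factor
\<open>p\<^sub>i\<^sub>j\<close>, a product of the law of \<open>W\<^sub>n\<close> on \<open>Y\<^sub>n = i\<close>, the service law \<open>F\<^sub>S\<^sub>,\<^sub>i\<close> and the exponential law with
rate \<open>l = \<lambda>\<^sub>j\<close> (\<open>joint_law_eq_pair_measure\<close>). If \<open>X = a W\<^sub>n + S\<^sub>n\<close>, integrating first over the
exponential variable gives
\<open>l / (l - s) * exp (- s X) - s / (l - s) * exp (- l X)\<close>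
(\<open>transform_reflected_exponential\<close>), and each exponential splits into a factor in \<open>W\<^sub>n\<close> and a factor
in \<open>S\<^sub>n\<close>. Summing over \<open>i\<close> and letting \<open>n\<close> tend to infinity yields
\<open>Z s = s F(s) v + H(s) Z(a s)\<close> (\<open>functional_equation\<close>).

Iterating along \<open>s, a s, a\<^sup>2 s, ...\<close> expresses \<open>Z s\<close> as a partial sum of the series plus
\<open>H(s) H(a s) ... H(a\<^sup>n\<^sup>-\<^sup>1 s) Z(a\<^sup>n s)\<close>, where \<open>Z(a\<^sup>n s)\<close> tends to \<open>Z 0 = \<pi>\<close>. All convergence rests on one
bound: the matrix products are bounded uniformly in \<open>n\<close>. In the \<open>l\<^sup>1\<close> norm the transpose of a
stochastic matrix and the transforms of the service times are contractions, so \<open>H(a\<^sup>m s)\<close> has norm at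
most the largest modulus of \<open>\<lambda>\<^sub>j / (\<lambda>\<^sub>j - a\<^sup>m s)\<close>, which is \<open>1 + O(a\<^sup>m)\<close>; these factors
have a convergent product (\<open>l1_norm_H_mat_le\<close>, \<open>norm_mat_prod_le\<close>). The series then converges
absolutely like a geometric series, and replacing \<open>Z(a\<^sup>n s)\<close> by \<open>\<pi>\<close> costs an error that vanishes. The
convergence of the infinite product applied to \<open>\<pi>\<close> thus comes out of the iteration
itself (\<open>backward_recursion_limit\<close>).\<close>

section \<open>Finite measures determined by lower orthants\<close>

text \<open>The lower orthants are closed under intersection, since \<open>{..b} \<inter> {..c} = {..inf b c}\<close>, they generate
the Borel sets, and countably many of them cover the space.\<close>
lemma finite_measure_eqI_atMost:
  fixes M N :: "'a::ordered_euclidean_space measure"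
  assumes "finite_measure M" and sets: "sets M = sets borel" "sets N = sets borel"
    and eq: "\<And>a. emeasure M {..a} = emeasure N {..a}"
  shows "M = N"
proof (rule measure_eqI_generator_eq)
  interpret finite_measure M by fact
  show "Int_stable (range (\<lambda>a::'a. {..a}))"
  proof (rule Int_stableI)
    fix B C assume "B \<in> range (\<lambda>a::'a. {..a})" "C \<in> range (\<lambda>a::'a. {..a})"
    then obtain b c :: 'a where "B = {..b}" "C = {..c}" by auto
    then have "B \<inter> C = {..inf b c}" by auto
    then show "B \<inter> C \<in> range (\<lambda>a::'a. {..a})" by blast
  qed
  show "range (\<lambda>a::'a. {..a}) \<subseteq> Pow UNIV" by simp
  show "\<And>X. X \<in> range (\<lambda>a::'a. {..a}) \<Longrightarrow> emeasure M X = emeasure N X"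
    using eq by auto
  have *: "sets (borel :: 'a measure) = sigma_sets UNIV (range (\<lambda>a::'a. {..a}))"
    by (subst borel_eq_atMost) (rule sets_measure_of, simp)
  show "sets M = sigma_sets UNIV (range (\<lambda>a::'a. {..a}))" using * sets by simp
  show "sets N = sigma_sets UNIV (range (\<lambda>a::'a. {..a}))" using * sets by simp
  show "range (\<lambda>n. {..real n *\<^sub>R (One::'a)}) \<subseteq> range (\<lambda>a::'a. {..a})" by auto
  have "\<exists>n::nat. x \<le> real n *\<^sub>R (One::'a)" for x :: 'a
  proof -
    obtain n :: nat where n: "norm x \<le> real n" using real_arch_simple by blast
    have "x \<bullet> i \<le> real n *\<^sub>R (One::'a) \<bullet> i" if "i \<in> Basis" for i
      using n Basis_le_norm[OF that, of x] that by (simp add: inner_sum_left_Basis)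
    then show ?thesis by (auto simp: eucl_le[where 'a='a])
  qed
  then show "(\<Union>n. {..real n *\<^sub>R (One::'a)}) = UNIV" by auto
  show "\<And>n. emeasure M {..real n *\<^sub>R (One::'a)} \<noteq> \<infinity>" by simp
qed

section \<open>Exponential laws and Laplace--Stieltjes transforms\<close>

lemma norm_exp_uminus_le_1:
  fixes z :: complex
  assumes "0 \<le> Re z" "0 \<le> x"
  shows "norm (exp (- (z * complex_of_real x))) \<le> 1"
  using assms by simp

lemma emeasure_exponential_atMost:
  assumes "0 < l"
  shows "emeasure (density lborel (exponential_density l)) {..x} =
    ennreal (if 0 \<le> x then 1 - exp (- (l * x)) else 0)"
  using assms by (simp add: emeasure_erlang_density erlang_CDF_0)

text \<open>An exponential interarrival time \<open>t\<close> empties a workload \<open>x\<close> exactly when \<open>t \<ge> x\<close>, which has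
probability \<open>exp (- l x)\<close>; on \<open>{0..x}\<close> the integrand has an elementary antiderivative because \<open>z\<close>
differs from \<open>l\<close>. Both exponentials on the right are multiplicative in \<open>x\<close>, which is what makes the
workload recursion solvable.\<close>
lemma transform_reflected_exponential:
  fixes z :: complex
  assumes l: "0 < l" and z: "z \<noteq> complex_of_real l" "0 \<le> Re z" and x: "0 \<le> x"
  shows "(LINT t|density lborel (exponential_density l). exp (- (z * complex_of_real (max 0 (x - t)))))
    = l / (l - z) * exp (- (z * x)) - z / (l - z) * exp (- (complex_of_real l * x))"
proof -
  let ?E = "density lborel (exponential_density l)"
  let ?f = "\<lambda>t. exp (- (z * complex_of_real (max 0 (x - t))))"
  interpret E: prob_space ?E using l by (rule prob_space_exponential_density)
  have bdd: "norm (?f t) \<le> 1" for t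
    by (rule norm_exp_uminus_le_1[OF z(2)]) simp
  have int: "integrable ?E ?f"
    by (rule E.integrable_const_bound[where B=1]) (use bdd in auto)
  have int1: "integrable ?E (\<lambda>t. indicator {..x} t *\<^sub>R ?f t)"
    by (rule integrable_mult_indicator[OF _ int]) simp
  have int2: "integrable ?E (\<lambda>t. indicator {x<..} t :: complex)"
    by (rule E.integrable_const_bound[where B=1]) (auto simp: indicator_def)
  have "(LINT t|?E. ?f t) = (LINT t|?E. indicator {..x} t *\<^sub>R ?f t + indicator {x<..} t)"
    by (rule Bochner_Integration.integral_cong) (auto simp: indicator_def)
  also have "\<dots> = (LINT t|?E. indicator {..x} t *\<^sub>R ?f t) + (LINT t|?E. indicator {x<..} t)"
    using int1 int2 by (rule Bochner_Integration.integral_add)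
  also have "(LINT t|?E. (indicator {x<..} t :: complex)) = complex_of_real (exp (- (l * x)))"
  proof -
    have "measure ?E {..x} = 1 - exp (- (l * x))"
      using emeasure_exponential_atMost[OF l, of x] x l by (simp add: measure_def)
    moreover have "measure ?E {x<..} = 1 - measure ?E {..x}"
      using E.prob_compl[of "{..x}"] by (simp add: Compl_eq_Diff_UNIV[symmetric] Compl_atMost)
    moreover have "(LINT t|?E. (indicator {x<..} t :: complex)) =
        (LINT t|?E. complex_of_real (indicator {x<..} t))"
      by (rule Bochner_Integration.integral_cong) (auto simp: indicator_def)
    ultimately show ?thesis by simp
  qed
  also have "(LINT t|?E. indicator {..x} t *\<^sub>R ?f t) =
    (LINT t|lborel. exponential_density l t *\<^sub>R (indicator {..x} t *\<^sub>R ?f t))"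
    by (rule integral_density) (auto simp: exponential_density_nonneg l)
  also have "\<dots> = (LINT t|lborel. indicator {0..x} t *\<^sub>R (l * exp (- (z * x)) * exp ((z - l) * t)))"
    by (rule Bochner_Integration.integral_cong)
       (auto simp: indicator_def exponential_density_def scaleR_conv_of_real exp_of_real[symmetric]
          exp_add[symmetric] algebra_simps simp del: exp_of_real)
  also have "\<dots> = l * exp (- (z * x)) / (z - l) * exp ((z - l) * x) - l * exp (- (z * x)) / (z - l) * exp ((z - l) * complex_of_real 0)"
  proof (rule integral_FTC_Icc)
    show "0 \<le> x" by fact
    show "((\<lambda>t. l * exp (- (z * x)) / (z - l) * exp ((z - l) * complex_of_real t)) has_vector_derivative
       l * exp (- (z * x)) * exp ((z - l) * complex_of_real t)) (at t within {0..x})" for t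
    proof -
      have "((\<lambda>w. c / k * exp (k * w)) has_field_derivative c * exp (k * t)) (at (complex_of_real t))"
        if "k \<noteq> 0" for c k :: complex
        using that by (auto intro!: derivative_eq_intros)
      from this[of "z - l" "l * exp (- (z * x))"]
      have "((\<lambda>w. l * exp (- (z * x)) / (z - l) * exp ((z - l) * w)) has_field_derivative
         l * exp (- (z * x)) * exp ((z - l) * t)) (at (complex_of_real t))"
        using z by simp
      from has_vector_derivative_real_field[OF this] show ?thesis .
    qed
    show "continuous_on {0..x} (\<lambda>t. l * exp (- (z * x)) * exp ((z - l) * complex_of_real t))"
      by (intro continuous_intros)
  qed
  also have "\<dots> + complex_of_real (exp (- (l * x)))
     = l / (l - z) * exp (- (z * x)) - z / (l - z) * exp (- (complex_of_real l * x))"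
  proof -
    have e: "exp (- (z * x)) * exp ((z - l) * x) = exp (- (complex_of_real l * x))"
      by (simp add: exp_add[symmetric] algebra_simps)
    have e': "complex_of_real (exp (- (l * x))) = exp (- (complex_of_real l * x))"
      by (simp add: exp_of_real[symmetric])
    have "z - l \<noteq> 0" "l - z \<noteq> 0" using z by auto
    then show ?thesis unfolding e' times_divide_eq_left mult.assoc e by (simp add: divide_simps) (simp add: algebra_simps)
  qed
  finally show ?thesis .
qed

lemma distribution_function_nonneg_interval_measure:
  assumes G: "distribution_function_nonneg G"
  shows real_distribution_of_df: "real_distribution (interval_measure G)"
    and emeasure_df_atMost: "emeasure (interval_measure G) {..x} = ennreal (G x)"
    and AE_df_nonneg: "AE t in interval_measure G. 0 \<le> t"
    and df_nonneg: "0 \<le> G x"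
proof -
  have mono: "\<And>x y. x \<le> y \<Longrightarrow> G x \<le> G y" and rc: "\<And>a. continuous (at_right a) G"
    and neg: "\<And>x. x < 0 \<Longrightarrow> G x = 0" and top: "(G \<longlongrightarrow> 1) at_top"
    using G by (auto simp: distribution_function_nonneg_def mono_def)
  have bot: "(G \<longlongrightarrow> 0) at_bot"
    by (rule tendsto_eventually) (auto simp: eventually_at_bot_dense neg intro!: exI[of _ 0])
  show rd: "real_distribution (interval_measure G)"
    using mono rc bot top by (rule real_distribution_interval_measure)
  show iic: "emeasure (interval_measure G) {..x} = ennreal (G x)" for x
    using mono rc bot by (rule emeasure_interval_measure_Iic)
  show "0 \<le> G x"
    using mono[of "min x (-1)" x] neg[of "min x (-1)"] by (simp add: min_def split: if_splits)
  have "(\<Union>n. {..- 1 / real (Suc n)}) \<in> null_sets (interval_measure G)"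
    by (rule null_sets_UN) (auto simp: null_sets_def iic neg)
  then show "AE t in interval_measure G. 0 \<le> t"
  proof (rule AE_I')
    show "{t \<in> space (interval_measure G). \<not> 0 \<le> t} \<subseteq> (\<Union>n. {..- 1 / real (Suc n)})"
    proof safe
      fix t :: real assume "\<not> 0 \<le> t"
      then obtain n where "inverse (real (Suc n)) < - t" using reals_Archimedean[of "-t"] by auto
      then show "t \<in> (\<Union>n. {..- 1 / real (Suc n)})" by (auto simp: field_simps intro!: exI[of _ n])
    qed
  qed
qed

text \<open>The measure of \<open>G\<close> lives on \<open>{0..}\<close>, so restricting the domain of integration changes nothing.\<close>
lemma LST_eq_integral:
  assumes "distribution_function_nonneg G"
  shows "LST G s = (LINT t|interval_measure G. exp (- (s * complex_of_real t)))"
  unfolding LST_def set_lebesgue_integral_def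
  by (rule integral_cong_AE) (use AE_df_nonneg[OF assms] in \<open>auto elim!: eventually_mono\<close>)

lemma integrable_LST:
  assumes "distribution_function_nonneg G" "0 \<le> Re s"
  shows "integrable (interval_measure G) (\<lambda>t. exp (- (s * complex_of_real t)))"
proof -
  interpret real_distribution "interval_measure G" using assms(1) by (rule real_distribution_of_df)
  show ?thesis
    by (rule integrable_const_bound[where B=1])
       (use AE_df_nonneg[OF assms(1)] assms(2) in \<open>auto elim!: eventually_mono\<close>)
qed

lemma norm_LST_le_1:
  assumes "distribution_function_nonneg G" "0 \<le> Re s"
  shows "norm (LST G s) \<le> 1"
proof -
  interpret real_distribution "interval_measure G" using assms(1) by (rule real_distribution_of_df)
  have "norm (LST G s) \<le> (LINT t|interval_measure G. norm (exp (- (s * complex_of_real t))))"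
    unfolding LST_eq_integral[OF assms(1)] by (rule integral_norm_bound)
  also have "\<dots> \<le> (LINT t|interval_measure G. 1)"
    by (rule integral_mono_AE[OF integrable_norm[OF integrable_LST[OF assms]]])
       (use AE_df_nonneg[OF assms(1)] assms(2) in \<open>auto elim!: eventually_mono\<close>)
  finally show ?thesis using prob_space by simp
qed

text \<open>Continuity on the closed half-plane: the integrands are dominated by the constant \<open>1\<close>.\<close>
lemma joint_transform_tendsto:
  fixes X :: "'v \<Rightarrow> 'n::finite"
  assumes "prob_space M" and [measurable]: "V \<in> borel_measurable M" "X \<in> measurable M (count_space UNIV)"
    and V0: "\<And>\<omega>. \<omega> \<in> space M \<Longrightarrow> 0 \<le> V \<omega>"
    and s: "\<And>n. 0 \<le> Re (s n)" "s \<longlonglongrightarrow> c"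
  shows "(\<lambda>n. joint_transform M V X (s n) i) \<longlonglongrightarrow> joint_transform M V X c i"
proof -
  interpret prob_space M by fact
  define E where "E = {\<omega> \<in> space M. X \<omega> = i}"
  have [measurable]: "E \<in> sets M" unfolding E_def by measurable
  have jt: "joint_transform M V X z i = (LINT \<omega>|M. exp (- (z * complex_of_real (V \<omega>))) * indicator E \<omega>)" for z
    unfolding joint_transform_def E_def by (rule Bochner_Integration.integral_cong) (auto simp: indicator_def)
  show ?thesis unfolding jt
  proof (rule integral_dominated_convergence[where w="\<lambda>_. 1"])
    show "AE \<omega> in M. (\<lambda>n. exp (- (s n * complex_of_real (V \<omega>))) * indicator E \<omega>)
        \<longlonglongrightarrow> exp (- (c * complex_of_real (V \<omega>))) * indicator E \<omega>"
      by (intro AE_I2 tendsto_intros s(2))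
    show "AE \<omega> in M. norm (exp (- (s n * complex_of_real (V \<omega>))) * indicator E \<omega>) \<le> 1" for n
      using V0 norm_exp_uminus_le_1[OF s(1)[of n]] by (intro AE_I2) (auto simp: indicator_def norm_mult)
  qed auto
qed

lemma joint_transform_0:
  assumes "prob_space M" and [measurable]: "X \<in> measurable M (count_space UNIV)"
  shows "joint_transform M V X 0 i = complex_of_real (\<P>(\<omega> in M. X \<omega> = i))"
proof -
  interpret prob_space M by fact
  have "joint_transform M V X 0 i = (LINT \<omega>|M. complex_of_real (indicator {\<omega> \<in> space M. X \<omega> = i} \<omega>))"
    unfolding joint_transform_def by (rule Bochner_Integration.integral_cong) (auto simp: indicator_def)
  then show ?thesis by simp
qed

section \<open>One step of the workload recursion\<close>

text \<open>The hypothesis \<open>law\<close> is a product formula for the distribution function of \<open>(W, S, A)\<close> on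
\<open>E \<inter> E'\<close>, where \<open>E\<close> and \<open>E'\<close> play the roles of \<open>Y\<^sub>n = i\<close> and \<open>Y\<^sub>n\<^sub>+\<^sub>1 = j\<close>. It says that the two
measures agree on lower orthants with nonnegative corner in \<open>S\<close> and \<open>A\<close>; on the
others both vanish. The transition probability \<open>q\<close> is absorbed into the law of \<open>W\<close>, so that the other two factors are probability measures and \<open>q = 0\<close> needs no separate treatment.\<close>
lemma joint_law_eq_pair_measure:
  fixes W S A :: "'w \<Rightarrow> real"
  assumes "prob_space M" and l: "0 < l" and G: "distribution_function_nonneg G" and q: "0 \<le> q"
    and [measurable]: "W \<in> borel_measurable M" "S \<in> borel_measurable M" "A \<in> borel_measurable M"
      "E \<in> sets M" "E' \<in> sets M"
    and S0: "\<And>\<omega>. \<omega> \<in> space M \<Longrightarrow> 0 \<le> S \<omega>" and A0: "\<And>\<omega>. \<omega> \<in> space M \<Longrightarrow> 0 \<le> A \<omega>"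
    and law: "\<And>w x y. 0 \<le> x \<Longrightarrow> 0 \<le> y \<Longrightarrow>
      measure M {\<omega> \<in> space M. W \<omega> \<le> w \<and> S \<omega> \<le> y \<and> A \<omega> \<le> x \<and> \<omega> \<in> E \<and> \<omega> \<in> E'} =
      q * G y * (1 - exp (- (l * x))) * measure M {\<omega> \<in> space M. W \<omega> \<le> w \<and> \<omega> \<in> E}"
  shows "distr (density M (\<lambda>\<omega>. ennreal (indicator (E \<inter> E') \<omega>))) borel (\<lambda>\<omega>. (W \<omega>, S \<omega>, A \<omega>)) =
    distr (density M (\<lambda>\<omega>. ennreal (q * indicator E \<omega>))) borel W \<Otimes>\<^sub>M
      (interval_measure G \<Otimes>\<^sub>M density lborel (exponential_density l))" (is "?L = ?N \<Otimes>\<^sub>M (?G \<Otimes>\<^sub>M ?X)")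
proof (rule finite_measure_eqI_atMost)
  interpret prob_space M by fact
  interpret X: prob_space ?X using l by (rule prob_space_exponential_density)
  interpret G: real_distribution ?G using G by (rule real_distribution_of_df)
  interpret GX: pair_prob_space ?G ?X ..
  \<comment> \<open>One formula evaluates both restricted measures: the left-hand side is the case \<open>c = 1\<close>.\<close>
  have em: "emeasure (density M (\<lambda>\<omega>. ennreal (c * indicator B \<omega>))) C = ennreal (c * measure M (B \<inter> C))"
    if "B \<in> sets M" "C \<in> sets M" "0 \<le> c" for B C c
  proof -
    have "emeasure (density M (\<lambda>\<omega>. ennreal (c * indicator B \<omega>))) C
        = (\<integral>\<^sup>+\<omega>. ennreal c * indicator (B \<inter> C) \<omega> \<partial>M)"
      using that by (subst emeasure_density) (auto intro!: nn_integral_cong simp: indicator_def)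
    also have "\<dots> = ennreal (c * measure M (B \<inter> C))"
      using that by (simp add: nn_integral_cmult_indicator emeasure_eq_measure ennreal_mult)
    finally show ?thesis .
  qed
  show "finite_measure ?L"
  proof
    show "emeasure ?L (space ?L) \<noteq> \<infinity>"
      using em[of "E \<inter> E'" "space M" 1] by (subst emeasure_distr) auto
  qed
  show "sets ?L = sets borel" by simp
  show "sets (?N \<Otimes>\<^sub>M (?G \<Otimes>\<^sub>M ?X)) = sets borel"
    by (simp add: borel_prod[symmetric] cong: sets_pair_measure_cong)
  fix p :: "real \<times> real \<times> real"
  obtain w y x where p: "p = (w, y, x)" by (cases p)
  have at: "{..p} = {..w} \<times> {..y} \<times> {..x}" by (auto simp: p)
  have "emeasure ?L {..p} = ennreal (measure M {\<omega> \<in> space M. W \<omega> \<le> w \<and> S \<omega> \<le> y \<and> A \<omega> \<le> x \<and> \<omega> \<in> E \<and> \<omega> \<in> E'})"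
  proof -
    have "(E \<inter> E') \<inter> ((\<lambda>\<omega>. (W \<omega>, S \<omega>, A \<omega>)) -` {..p} \<inter> space M) =
        {\<omega> \<in> space M. W \<omega> \<le> w \<and> S \<omega> \<le> y \<and> A \<omega> \<le> x \<and> \<omega> \<in> E \<and> \<omega> \<in> E'}"
      by (auto simp: p)
    moreover have "(\<lambda>\<omega>. (W \<omega>, S \<omega>, A \<omega>)) -` {..p} \<inter> space M \<in> sets M"
      by (rule measurable_sets[of _ M borel]) auto
    ultimately show ?thesis
      using em[of "E \<inter> E'" "(\<lambda>\<omega>. (W \<omega>, S \<omega>, A \<omega>)) -` {..p} \<inter> space M" 1]
      by (subst emeasure_distr) auto
  qed
  also have "\<dots> = ennreal (q * measure M {\<omega> \<in> space M. W \<omega> \<le> w \<and> \<omega> \<in> E}) *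
      (ennreal (if 0 \<le> y then G y else 0) * ennreal (if 0 \<le> x then 1 - exp (- (l * x)) else 0))"
  proof (cases "0 \<le> x \<and> 0 \<le> y")
    case True
    then show ?thesis using law[of x y w] q l df_nonneg[OF G, of y]
      by (simp add: ennreal_mult[symmetric] mult_ac)
  next
    case False
    then have empty: "{\<omega> \<in> space M. W \<omega> \<le> w \<and> S \<omega> \<le> y \<and> A \<omega> \<le> x \<and> \<omega> \<in> E \<and> \<omega> \<in> E'} = {}"
      using S0 A0 by force
    show ?thesis unfolding empty using False by auto
  qed
  also have "\<dots> = emeasure ?N {..w} * (emeasure ?G {..y} * emeasure ?X {..x})"
  proof -
    have "E \<inter> (W -` {..w} \<inter> space M) = {\<omega> \<in> space M. W \<omega> \<le> w \<and> \<omega> \<in> E}"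
      by auto
    then have "emeasure ?N {..w} = ennreal (q * measure M {\<omega> \<in> space M. W \<omega> \<le> w \<and> \<omega> \<in> E})"
      using em[of E "W -` {..w} \<inter> space M" q] q by (subst emeasure_distr) auto
    moreover have "G y = 0" if "\<not> 0 \<le> y"
      using G that by (simp add: distribution_function_nonneg_def)
    ultimately show ?thesis
      using emeasure_exponential_atMost[OF l, of x] emeasure_df_atMost[OF G, of y]
      by auto
  qed
  also have "\<dots> = emeasure (?N \<Otimes>\<^sub>M (?G \<Otimes>\<^sub>M ?X)) {..p}"
    unfolding at
    by (simp add: GX.emeasure_pair_measure_Times X.emeasure_pair_measure_Times del: emeasure_distr)
  finally show "emeasure ?L {..p} = emeasure (?N \<Otimes>\<^sub>M (?G \<Otimes>\<^sub>M ?X)) {..p}" .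
qed

text \<open>With the interarrival time integrated innermost, \<open>transform_reflected_exponential\<close> applies with
\<open>x = a W + S\<close>, and each of its two terms is a product of a function of \<open>W\<close> and a function of \<open>S\<close>. The
second term is the source of the values of the transforms at \<open>l\<close> and \<open>a l\<close>.\<close>
lemma one_step_transform:
  fixes W S A :: "'w \<Rightarrow> real" and z :: complex
  assumes "prob_space M" and l: "0 < l" and G: "distribution_function_nonneg G"
    and q: "0 \<le> q" and a: "0 < a"
    and meas [measurable]: "W \<in> borel_measurable M" "S \<in> borel_measurable M" "A \<in> borel_measurable M"
      "E \<in> sets M" "E' \<in> sets M"
    and W0: "\<And>\<omega>. \<omega> \<in> space M \<Longrightarrow> 0 \<le> W \<omega>"
    and S0: "\<And>\<omega>. \<omega> \<in> space M \<Longrightarrow> 0 \<le> S \<omega>" and A0: "\<And>\<omega>. \<omega> \<in> space M \<Longrightarrow> 0 \<le> A \<omega>"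
    and law: "\<And>w x y. 0 \<le> x \<Longrightarrow> 0 \<le> y \<Longrightarrow>
      measure M {\<omega> \<in> space M. W \<omega> \<le> w \<and> S \<omega> \<le> y \<and> A \<omega> \<le> x \<and> \<omega> \<in> E \<and> \<omega> \<in> E'} =
      q * G y * (1 - exp (- (l * x))) * measure M {\<omega> \<in> space M. W \<omega> \<le> w \<and> \<omega> \<in> E}"
    and z: "0 \<le> Re z" "z \<noteq> complex_of_real l"
  shows "(LINT \<omega>|M. exp (- (z * complex_of_real (max 0 (a * W \<omega> + S \<omega> - A \<omega>)))) * indicator (E \<inter> E') \<omega>) =
    complex_of_real q *
      (l / (l - z) * LST G z * (LINT \<omega>|M. exp (- (a * z * complex_of_real (W \<omega>))) * indicator E \<omega>)
       - z / (l - z) * LST G l * (LINT \<omega>|M. exp (- (complex_of_real (a * l) * complex_of_real (W \<omega>))) * indicator E \<omega>))"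
proof -
  let ?L = "distr (density M (\<lambda>\<omega>. ennreal (indicator (E \<inter> E') \<omega>))) borel (\<lambda>\<omega>. (W \<omega>, S \<omega>, A \<omega>))"
  let ?N = "distr (density M (\<lambda>\<omega>. ennreal (q * indicator E \<omega>))) borel W"
  let ?G = "interval_measure G" and ?X = "density lborel (exponential_density l)"
  let ?f = "\<lambda>w s t. exp (- (z * complex_of_real (max 0 (a * w + s - t))))"
  have joint: "?L = ?N \<Otimes>\<^sub>M (?G \<Otimes>\<^sub>M ?X)"
    by (rule joint_law_eq_pair_measure[OF assms(1) l G q meas S0 A0 law])
  interpret prob_space M by fact
  interpret X: prob_space ?X using l by (rule prob_space_exponential_density)
  interpret G: real_distribution ?G using G by (rule real_distribution_of_df)
  interpret GX: pair_prob_space ?G ?X ..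
  interpret N: finite_measure ?N
  proof
    have "emeasure ?N (space ?N) = (\<integral>\<^sup>+\<omega>. ennreal q * indicator E \<omega> \<partial>M)"
      by (subst emeasure_distr) (auto simp: emeasure_density q indicator_def intro!: nn_integral_cong)
    then show "emeasure ?N (space ?N) \<noteq> \<infinity>"
      by (simp add: nn_integral_cmult_indicator emeasure_eq_measure ennreal_mult_eq_top_iff)
  qed
  interpret NGX: pair_sigma_finite ?N "?G \<Otimes>\<^sub>M ?X" ..
  interpret P: finite_measure "?N \<Otimes>\<^sub>M (?G \<Otimes>\<^sub>M ?X)"
    by (rule finite_measure_pair_measure) unfold_locales
  have bdd: "norm (?f w s t) \<le> 1" for w s t
    by (rule norm_exp_uminus_le_1[OF z(1)]) simp
  have fm: "(\<lambda>p. ?f (fst p) (fst (snd p)) (snd (snd p))) \<in> borel_measurable (borel \<Otimes>\<^sub>M (borel \<Otimes>\<^sub>M borel))"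
    by measurable
  have N_AE: "AE w in ?N. 0 \<le> w"
    by (subst AE_distr_iff) (auto simp: AE_density W0)
  have N_int: "(LINT w|?N. exp (- (c * complex_of_real w))) =
      complex_of_real q * (LINT \<omega>|M. exp (- (c * complex_of_real (W \<omega>))) * indicator E \<omega>)" for c
  proof -
    have "(LINT w|?N. exp (- (c * complex_of_real w))) =
        (LINT \<omega>|M. (q * indicator E \<omega>) *\<^sub>R exp (- (c * complex_of_real (W \<omega>))))"
      using q by (simp add: integral_distr integral_density)
    also have "\<dots> = (LINT \<omega>|M. complex_of_real q * (exp (- (c * complex_of_real (W \<omega>))) * indicator E \<omega>))"
      by (rule Bochner_Integration.integral_cong) (auto simp: indicator_def scaleR_conv_of_real)
    finally show ?thesis by simp
  qed
  have N_integrable: "integrable ?N (\<lambda>w. exp (- (c * complex_of_real w)))" if "0 \<le> Re c" for c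
    by (rule N.integrable_const_bound[where B=1])
       (use N_AE that in \<open>auto elim!: eventually_mono\<close>)
  have "(LINT \<omega>|M. exp (- (z * complex_of_real (max 0 (a * W \<omega> + S \<omega> - A \<omega>)))) * indicator (E \<inter> E') \<omega>)
    = (LINT \<omega>|M. indicator (E \<inter> E') \<omega> *\<^sub>R ?f (W \<omega>) (S \<omega>) (A \<omega>))"
    by (rule Bochner_Integration.integral_cong) (auto simp: indicator_def)
  also have "\<dots> = (LINT p|?L. ?f (fst p) (fst (snd p)) (snd (snd p)))"
    by (subst integral_distr) (auto simp: integral_density borel_prod[symmetric] intro: fm)
  also have "\<dots> = (LINT p|(?N \<Otimes>\<^sub>M (?G \<Otimes>\<^sub>M ?X)). ?f (fst p) (fst (snd p)) (snd (snd p)))"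
    unfolding joint ..
  also have "\<dots> = (LINT w|?N. LINT u|(?G \<Otimes>\<^sub>M ?X). ?f w (fst u) (snd u))"
  proof -
    have "integrable (?N \<Otimes>\<^sub>M (?G \<Otimes>\<^sub>M ?X)) (\<lambda>p. ?f (fst p) (fst (snd p)) (snd (snd p)))"
      by (rule P.integrable_const_bound[where B=1]) (use bdd in auto)
    from NGX.integral_fst'[OF this] show ?thesis by simp
  qed
  also have "\<dots> = (LINT w|?N. LINT s|?G. LINT t|?X. ?f w s t)"
  proof (rule Bochner_Integration.integral_cong[OF refl])
    fix w
    have "integrable (?G \<Otimes>\<^sub>M ?X) (\<lambda>u. ?f w (fst u) (snd u))"
      by (rule GX.P.integrable_const_bound[where B=1]) (use bdd in auto)
    from GX.integral_fst'[OF this]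
    show "(LINT u|(?G \<Otimes>\<^sub>M ?X). ?f w (fst u) (snd u)) = (LINT s|?G. LINT t|?X. ?f w s t)" by simp
  qed
  also have "\<dots> = (LINT w|?N. l / (l - z) * LST G z * exp (- (a * z * w))
       - z / (l - z) * LST G l * exp (- (complex_of_real (a * l) * w)))"
  proof (rule integral_cong_AE)
    show "AE w in ?N. (LINT s|?G. LINT t|?X. ?f w s t) = l / (l - z) * LST G z * exp (- (a * z * w))
       - z / (l - z) * LST G l * exp (- (complex_of_real (a * l) * w))"
      using N_AE
    proof eventually_elim
      case (elim w)
      have "(LINT s|?G. LINT t|?X. ?f w s t) =
        (LINT s|?G. l / (l - z) * exp (- (a * z * w)) * exp (- (z * s))
           - z / (l - z) * exp (- (complex_of_real (a * l) * w)) * exp (- (complex_of_real l * s)))"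
      proof (rule integral_cong_AE)
        show "AE s in ?G. (LINT t|?X. ?f w s t) = l / (l - z) * exp (- (a * z * w)) * exp (- (z * s))
           - z / (l - z) * exp (- (complex_of_real (a * l) * w)) * exp (- (complex_of_real l * s))"
          using AE_df_nonneg[OF G]
        proof eventually_elim
          case (elim s)
          have "0 \<le> a * w + s" using elim \<open>0 \<le> w\<close> a by simp
          from transform_reflected_exponential[OF l z(2,1) this]
          show ?case by (simp add: exp_add[symmetric] algebra_simps)
        qed
      qed auto
      also have "\<dots> = l / (l - z) * exp (- (a * z * w)) * LST G z
           - z / (l - z) * exp (- (complex_of_real (a * l) * w)) * LST G l"
        unfolding LST_eq_integral[OF G] using integrable_LST[OF G, of z] integrable_LST[OF G, of l] z l
        by (subst Bochner_Integration.integral_diff) auto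
      finally show ?case by (simp add: mult_ac)
    qed
  qed auto
  also have "\<dots> = l / (l - z) * LST G z * (LINT w|?N. exp (- (a * z * w)))
       - z / (l - z) * LST G l * (LINT w|?N. exp (- (complex_of_real (a * l) * w)))"
    using N_integrable[of "a * z"] N_integrable[of "complex_of_real (a * l)"] z l a
    by (subst Bochner_Integration.integral_diff) auto
  also have "\<dots> = complex_of_real q *
      (l / (l - z) * LST G z * (LINT \<omega>|M. exp (- (a * z * complex_of_real (W \<omega>))) * indicator E \<omega>)
       - z / (l - z) * LST G l * (LINT \<omega>|M. exp (- (complex_of_real (a * l) * complex_of_real (W \<omega>))) * indicator E \<omega>))"
    unfolding N_int by (simp add: algebra_simps)
  finally show ?thesis .
qed

text \<open>Conditional independence splits off the workload, and the conditional law of the triple supplies the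
remaining factor. Both are conditional on \<open>Y\<^sub>n = i\<close> and say nothing when that event is null, but then
both sides vanish.\<close>
lemma one_step_law:
  fixes P :: "real^'n^'n"
  assumes M: "prob_space M"
    and Y: "\<And>n. Y n \<in> measurable M (count_space UNIV)"
    and W: "\<And>n. W n \<in> borel_measurable M"
    and ci: "conditionally_independent_of_past M Y W A S"
    and law: "conditional_triple_law M P lam FS Y A S"
    and xy: "0 \<le> x" "0 \<le> y"
  shows "measure M {\<omega> \<in> space M. W n \<omega> \<le> w \<and> S n \<omega> \<le> y \<and> A (Suc n) \<omega> \<le> x \<and> Y n \<omega> = i \<and> Y (Suc n) \<omega> = j} =
    P $ i $ j * FS i y * (1 - exp (- (lam j * x))) * measure M {\<omega> \<in> space M. W n \<omega> \<le> w \<and> Y n \<omega> = i}"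
proof -
  interpret prob_space M by fact
  note [measurable] = Y W
  have Yset [measurable]: "{\<omega> \<in> space M. Y n \<omega> = i} \<in> sets M" by measurable
  show ?thesis
  proof (cases "\<P>(\<omega> in M. Y n \<omega> = i) > 0")
    case False
    then have 0: "measure M {\<omega> \<in> space M. Y n \<omega> = i} = 0"
      by (simp add: zero_less_measure_iff)
    have null: "measure M B = 0" if "B \<subseteq> {\<omega> \<in> space M. Y n \<omega> = i}" for B
    proof (cases "B \<in> sets M")
      case True
      then show ?thesis using finite_measure_mono[OF that Yset] 0 measure_nonneg[of M B] by simp
    qed (rule measure_notin_sets)
    have "measure M {\<omega> \<in> space M. W n \<omega> \<le> w \<and> S n \<omega> \<le> y \<and> A (Suc n) \<omega> \<le> x \<and> Y n \<omega> = i \<and> Y (Suc n) \<omega> = j} = 0"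
      by (rule null) auto
    moreover have "measure M {\<omega> \<in> space M. W n \<omega> \<le> w \<and> Y n \<omega> = i} = 0" by (rule null) auto
    ultimately show ?thesis by simp
  next
    case True
    let ?D = "{..x} \<times> {..y} \<times> {j}" and ?B = "W n -` {..w} \<inter> space M"
    have D: "?D \<in> sets (borel \<Otimes>\<^sub>M borel \<Otimes>\<^sub>M count_space UNIV)" by auto
    have "?B \<in> {W k -` B \<inter> space M | k B. k \<le> n \<and> B \<in> sets borel}"
      by (intro CollectI exI[of _ n] exI[of _ "{..w}"]) auto
    then have B: "?B \<in> past_events M Y W A S n"
      unfolding past_events_def by (intro sigma_sets.Basic) blast
    have ci': "\<P>(\<omega> in M. ((A (Suc n) \<omega>, S n \<omega>, Y (Suc n) \<omega>) \<in> ?D \<and> \<omega> \<in> ?B) \<bar> Y n \<omega> = i) =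
        \<P>(\<omega> in M. (A (Suc n) \<omega>, S n \<omega>, Y (Suc n) \<omega>) \<in> ?D \<bar> Y n \<omega> = i) *
        \<P>(\<omega> in M. \<omega> \<in> ?B \<bar> Y n \<omega> = i)"
      using ci B D True unfolding conditionally_independent_of_past_def by blast
    have law': "\<P>(\<omega> in M. (A (Suc n) \<omega>, S n \<omega>, Y (Suc n) \<omega>) \<in> ?D \<bar> Y n \<omega> = i) =
        P $ i $ j * FS i y * (1 - exp (- (lam j * x)))"
      using law xy True unfolding conditional_triple_law_def by simp
    have "measure M {\<omega> \<in> space M. ((A (Suc n) \<omega>, S n \<omega>, Y (Suc n) \<omega>) \<in> ?D \<and> \<omega> \<in> ?B) \<and> Y n \<omega> = i} =
        P $ i $ j * FS i y * (1 - exp (- (lam j * x))) * measure M {\<omega> \<in> space M. \<omega> \<in> ?B \<and> Y n \<omega> = i}"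
      using ci'[unfolded law'] True unfolding cond_prob_def by (simp add: field_simps)
    moreover have "{\<omega> \<in> space M. ((A (Suc n) \<omega>, S n \<omega>, Y (Suc n) \<omega>) \<in> ?D \<and> \<omega> \<in> ?B) \<and> Y n \<omega> = i} =
        {\<omega> \<in> space M. W n \<omega> \<le> w \<and> S n \<omega> \<le> y \<and> A (Suc n) \<omega> \<le> x \<and> Y n \<omega> = i \<and> Y (Suc n) \<omega> = j}"
      by auto
    moreover have "{\<omega> \<in> space M. \<omega> \<in> ?B \<and> Y n \<omega> = i} = {\<omega> \<in> space M. W n \<omega> \<le> w \<and> Y n \<omega> = i}"
      by auto
    ultimately show ?thesis by simp
  qed
qed

text \<open>Splitting according to the value of \<open>Y\<^sub>n\<close> reduces the transform after one step to the events
treated in \<open>one_step_transform\<close>.\<close>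
lemma joint_transform_Suc:
  fixes P :: "real^'n^'n" and s :: complex
  assumes M: "prob_space M" and a: "0 < a"
    and P: "stochastic_matrix P"
    and lam: "\<And>j. 0 < lam j"
    and FS: "\<And>i. distribution_function_nonneg (FS i)"
    and Y: "\<And>n. Y n \<in> measurable M (count_space UNIV)"
    and W: "\<And>n. W n \<in> borel_measurable M"
    and A: "\<And>n. A (Suc n) \<in> borel_measurable M"
    and S: "\<And>n. S n \<in> borel_measurable M"
    and W0: "\<And>n \<omega>. \<omega> \<in> space M \<Longrightarrow> 0 \<le> W n \<omega>"
    and A0: "\<And>n \<omega>. \<omega> \<in> space M \<Longrightarrow> 0 \<le> A (Suc n) \<omega>"
    and S0: "\<And>n \<omega>. \<omega> \<in> space M \<Longrightarrow> 0 \<le> S n \<omega>"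
    and rec: "\<And>n \<omega>. \<omega> \<in> space M \<Longrightarrow> W (Suc n) \<omega> = max 0 (a * W n \<omega> + S n \<omega> - A (Suc n) \<omega>)"
    and ci: "conditionally_independent_of_past M Y W A S"
    and law: "conditional_triple_law M P lam FS Y A S"
    and s: "0 \<le> Re s" "s \<noteq> complex_of_real (lam j)"
  shows "joint_transform M (W (Suc n)) (Y (Suc n)) s j =
    (\<Sum>i\<in>UNIV. complex_of_real (P $ i $ j) *
      (lam j / (lam j - s) * LST (FS i) s * joint_transform M (W n) (Y n) (a * s) i
       - s / (lam j - s) * LST (FS i) (lam j) * joint_transform M (W n) (Y n) (complex_of_real (a * lam j)) i))"
proof -
  interpret prob_space M by fact
  note [measurable] = Y W A S
  define E where "E k i = {\<omega> \<in> space M. Y k \<omega> = i}" for k i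
  have E [measurable]: "E k i \<in> sets M" for k i unfolding E_def by measurable
  let ?f = "\<lambda>\<omega>. exp (- (s * complex_of_real (max 0 (a * W n \<omega> + S n \<omega> - A (Suc n) \<omega>))))"
  have jt: "joint_transform M (W n) (Y n) c i = (LINT \<omega>|M. exp (- (c * complex_of_real (W n \<omega>))) * indicator (E n i) \<omega>)" for c i
    unfolding joint_transform_def E_def by (rule Bochner_Integration.integral_cong) (auto simp: indicator_def)
  have "joint_transform M (W (Suc n)) (Y (Suc n)) s j = (LINT \<omega>|M. (\<Sum>i\<in>UNIV. ?f \<omega> * indicator (E n i \<inter> E (Suc n) j) \<omega>))"
    unfolding joint_transform_def
  proof (rule Bochner_Integration.integral_cong[OF refl])
    fix \<omega> assume \<omega>: "\<omega> \<in> space M"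
    have "(\<Sum>i\<in>UNIV. ?f \<omega> * indicator (E n i \<inter> E (Suc n) j) \<omega>) =
      (\<Sum>i\<in>UNIV. if i = Y n \<omega> then ?f \<omega> * indicator (E (Suc n) j) \<omega> else 0)"
      by (rule sum.cong) (auto simp: E_def indicator_def \<omega>)
    then show "exp (- (s * complex_of_real (W (Suc n) \<omega>))) * indicator {\<omega>. Y (Suc n) \<omega> = j} \<omega> =
      (\<Sum>i\<in>UNIV. ?f \<omega> * indicator (E n i \<inter> E (Suc n) j) \<omega>)"
      using \<omega> by (simp add: rec E_def indicator_def)
  qed
  also have "\<dots> = (\<Sum>i\<in>UNIV. LINT \<omega>|M. ?f \<omega> * indicator (E n i \<inter> E (Suc n) j) \<omega>)"
  proof (rule Bochner_Integration.integral_sum)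
    fix i
    have "norm (?f \<omega> * indicator (E n i \<inter> E (Suc n) j) \<omega>) \<le> 1" for \<omega>
      using norm_exp_uminus_le_1[OF s(1), of "max 0 (a * W n \<omega> + S n \<omega> - A (Suc n) \<omega>)"]
      by (auto simp: indicator_def norm_mult)
    then show "integrable M (\<lambda>\<omega>. ?f \<omega> * indicator (E n i \<inter> E (Suc n) j) \<omega>)"
      by (intro integrable_const_bound[where B=1]) auto
  qed
  also have "\<dots> = (\<Sum>i\<in>UNIV. complex_of_real (P $ i $ j) *
      (lam j / (lam j - s) * LST (FS i) s * joint_transform M (W n) (Y n) (a * s) i
       - s / (lam j - s) * LST (FS i) (lam j) * joint_transform M (W n) (Y n) (complex_of_real (a * lam j)) i))"
    unfolding jt
  proof (rule sum.cong[OF refl], rule one_step_transform)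
    fix i w x y assume xy: "0 \<le> (x::real)" "0 \<le> (y::real)"
    show "measure M {\<omega> \<in> space M. W n \<omega> \<le> w \<and> S n \<omega> \<le> y \<and> A (Suc n) \<omega> \<le> x \<and> \<omega> \<in> E n i \<and> \<omega> \<in> E (Suc n) j} =
       P $ i $ j * FS i y * (1 - exp (- (lam j * x))) * measure M {\<omega> \<in> space M. W n \<omega> \<le> w \<and> \<omega> \<in> E n i}"
      using one_step_law[OF M Y W ci law xy, of n w i j] by (simp add: E_def cong: conj_cong)
  qed (use P in \<open>auto simp: M lam FS a W0 S0 A0 s stochastic_matrix_def\<close>)
  finally show ?thesis .
qed

section \<open>The functional equation\<close>

lemma diag_mult_vec: "(diag d *v x) $ i = d i * x $ i"
  by (simp add: diag_def matrix_vector_mult_def if_distrib[of "\<lambda>c. c * _"] cong: if_cong)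

lemma matrix_inv_diag:
  assumes "\<And>i. d i \<noteq> 0"
  shows "matrix_inv (diag d) = diag (\<lambda>i. inverse (d i))"
proof -
  have mult: "diag c ** diag e = diag (\<lambda>i. c i * e i)" for c e :: "'n::finite \<Rightarrow> complex"
    by (simp add: diag_def matrix_matrix_mult_def vec_eq_iff if_distrib[of "\<lambda>c. c * _"] cong: if_cong)
  have one: "diag (\<lambda>i. 1) = (mat 1 :: complex^'n^'n)"
    by (simp add: diag_def mat_def)
  have inv: "diag d ** diag (\<lambda>i. inverse (d i)) = mat 1" "diag (\<lambda>i. inverse (d i)) ** diag d = mat 1"
    using assms by (simp_all add: mult one)
  then have "\<exists>A'. diag d ** A' = mat 1 \<and> A' ** diag d = mat 1" by blast
  then have "matrix_inv (diag d) ** diag d = mat 1"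
    unfolding matrix_inv_def by (rule someI2_ex) simp
  then show ?thesis using inv(1) by (metis matrix_mul_assoc matrix_mul_lid matrix_mul_rid)
qed

lemma H_mat_mult_vec:
  "(H_mat P lam FS s *v x) $ j = complex_of_real (lam j) / (complex_of_real (lam j) - s) *
     (\<Sum>i\<in>UNIV. complex_of_real (P $ i $ j) * (LST (FS i) s * x $ i))"
  unfolding H_mat_def L_mat_def B_mat_def
  by (simp add: matrix_vector_mul_assoc[symmetric] diag_mult_vec)
     (simp add: vector_matrix_mult_def map_matrix_def diag_mult_vec mult_ac)

lemma F_mat_mult_vec:
  assumes "\<And>j. 0 < lam j"
  shows "(F_mat (lam :: 'n::finite \<Rightarrow> real) s *v x) $ j = - (x $ j / (complex_of_real (lam j) - s))"
proof -
  have "lam j \<noteq> 0" for j using assms[of j] by simp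
  moreover have "(- B) *v x = - (B *v x)" for B :: "complex^'n^'n"
    by (simp add: matrix_vector_mult_def vec_eq_iff sum_negf)
  ultimately show ?thesis
    unfolding F_mat_def L_mat_def Lam_mat_def
    by (simp add: matrix_inv_diag matrix_vector_mul_assoc[symmetric] diag_mult_vec divide_simps)
qed

text \<open>The limit of the one-step identities for a sequence of transforms \<open>T n\<close>. The points \<open>s\<close>, \<open>a s\<close> and
\<open>a \<lambda>\<^sub>j\<close> all lie in the half-plane where \<open>T n\<close> converges; the terms evaluated at \<open>a \<lambda>\<^sub>j\<close> do not
involve \<open>s\<close> and collect into the vector \<open>v\<close>.\<close>
lemma functional_equation:
  fixes P :: "real^'n^'n" and lam :: "'n \<Rightarrow> real" and Z :: "complex \<Rightarrow> complex^'n"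
    and s :: complex and T :: "nat \<Rightarrow> complex \<Rightarrow> 'n \<Rightarrow> complex"
  assumes lam: "\<And>j. 0 < lam j" and a: "0 < a"
    and step: "\<And>n j. s \<noteq> complex_of_real (lam j) \<Longrightarrow> T (Suc n) s j =
      (\<Sum>i\<in>UNIV. complex_of_real (P $ i $ j) *
        (lam j / (lam j - s) * LST (FS i) s * T n (a * s) i
         - s / (lam j - s) * LST (FS i) (lam j) * T n (complex_of_real (a * lam j)) i))"
    and lim: "\<And>s i. 0 \<le> Re s \<Longrightarrow> (\<lambda>n. T n s i) \<longlonglongrightarrow> Z s $ i"
    and s: "0 \<le> Re s" "\<And>j. s \<noteq> complex_of_real (lam j)"
  shows "Z s = s *s (F_mat lam s *v v_vec P lam FS a Z) + H_mat P lam FS s *v Z (a * s)"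
proof (rule vec_eq_iff[THEN iffD2], rule allI)
  fix j
  have "(\<lambda>n. T (Suc n) s j) \<longlonglongrightarrow> (\<Sum>i\<in>UNIV. complex_of_real (P $ i $ j) *
        (lam j / (lam j - s) * LST (FS i) s * Z (a * s) $ i
         - s / (lam j - s) * LST (FS i) (lam j) * Z (complex_of_real (a * lam j)) $ i))"
    unfolding step[OF s(2)]
    using s a lam[of j] by (intro tendsto_intros lim) auto
  moreover have "(\<lambda>n. T (Suc n) s j) \<longlonglongrightarrow> Z s $ j"
    using lim[OF s(1)] by (rule LIMSEQ_Suc)
  ultimately have "Z s $ j = (\<Sum>i\<in>UNIV. complex_of_real (P $ i $ j) *
        (lam j / (lam j - s) * LST (FS i) s * Z (a * s) $ i
         - s / (lam j - s) * LST (FS i) (lam j) * Z (complex_of_real (a * lam j)) $ i))"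
    by (rule LIMSEQ_unique[rotated])
  also have "\<dots> = lam j / (lam j - s) * (\<Sum>i\<in>UNIV. complex_of_real (P $ i $ j) * (LST (FS i) s * Z (a * s) $ i))
      - s / (lam j - s) * v_vec P lam FS a Z $ j"
    by (simp add: v_vec_def sum_subtractf sum_distrib_left right_diff_distrib mult_ac)
  also have "\<dots> = (s *s (F_mat lam s *v v_vec P lam FS a Z) + H_mat P lam FS s *v Z (a * s)) $ j"
    by (simp add: F_mat_mult_vec[OF lam] H_mat_mult_vec)
  finally show "Z s $ j = \<dots>" .
qed

section \<open>Iterating an affine recursion backwards\<close>

lemma backward_recursion_unroll:
  fixes z b :: "nat \<Rightarrow> complex^'n"
  assumes "\<And>n. z n = b n + Q n *v z (Suc n)"
  shows "z 0 = (\<Sum>k<n. mat_prod Q k *v b k) + mat_prod Q n *v z n"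
proof (induction n)
  case (Suc n)
  have "mat_prod Q n *v z n = mat_prod Q n *v b n + mat_prod Q (Suc n) *v z (Suc n)"
    by (subst assms) (simp add: matrix_vector_right_distrib matrix_vector_mul_assoc)
  with Suc show ?case by (simp add: add.assoc)
qed simp

text \<open>If the matrix products are bounded, the series converges absolutely, so the remainder
\<open>mat_prod Q n *v z n\<close> of the unrolled recursion converges as well; boundedness also shows that
replacing \<open>z n\<close> by its limit \<open>p\<close> in that remainder does not change its limit.\<close>
lemma backward_recursion_limit:
  fixes z b :: "nat \<Rightarrow> complex^'n"
  assumes rec: "\<And>n. z n = b n + Q n *v z (Suc n)"
    and bdd: "\<And>n x. norm (mat_prod Q n *v x) \<le> K * norm x"
    and b: "summable (\<lambda>n. norm (b n))" and z: "z \<longlonglongrightarrow> p"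
  shows "(\<lambda>n. mat_prod Q n *v p) \<longlonglongrightarrow> z 0 - (\<Sum>n. mat_prod Q n *v b n)"
proof -
  have "summable (\<lambda>n. mat_prod Q n *v b n)"
    by (rule summable_comparison_test'[OF summable_mult[OF b]]) (rule bdd)
  then have "(\<lambda>n. z 0 - (\<Sum>k<n. mat_prod Q k *v b k)) \<longlonglongrightarrow> z 0 - (\<Sum>n. mat_prod Q n *v b n)"
    by (intro tendsto_intros summable_LIMSEQ)
  then have 1: "(\<lambda>n. mat_prod Q n *v z n) \<longlonglongrightarrow> z 0 - (\<Sum>n. mat_prod Q n *v b n)"
  proof (rule Lim_transform_eventually, intro always_eventually allI)
    show "z 0 - (\<Sum>k<n. mat_prod Q k *v b k) = mat_prod Q n *v z n" for n
      using backward_recursion_unroll[of z b Q, OF rec, of n] by simp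
  qed
  have "(\<lambda>n. mat_prod Q n *v (p - z n)) \<longlonglongrightarrow> 0"
  proof (rule Lim_null_comparison)
    show "\<forall>\<^sub>F n in sequentially. norm (mat_prod Q n *v (p - z n)) \<le> K * norm (p - z n)"
      using bdd by simp
    have "(\<lambda>n. K * norm (p - z n)) \<longlonglongrightarrow> K * norm (p - p)" by (intro tendsto_intros z)
    then show "(\<lambda>n. K * norm (p - z n)) \<longlonglongrightarrow> 0" by simp
  qed
  from tendsto_add[OF 1 this] show ?thesis
    by (simp add: matrix_vector_right_distrib[symmetric])
qed

section \<open>Uniform bounds on the matrix products\<close>

text \<open>The \<open>l\<^sup>1\<close> norm is the natural one here: the rows of \<open>P\<close> sum to one, so its transpose is an
\<open>l\<^sup>1\<close> contraction, whereas it need not contract the Euclidean norm carried by \<open>complex^'n\<close>.\<close>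
lemma l1_norm_H_mat_le:
  assumes P: "stochastic_matrix P"
    and lst: "\<And>i. norm (LST (FS i) s) \<le> 1"
    and c: "\<And>j. norm (complex_of_real (lam j) / (complex_of_real (lam j) - s)) \<le> c"
  shows "(\<Sum>j\<in>UNIV. norm ((H_mat P lam FS s *v x) $ j)) \<le> c * (\<Sum>i\<in>UNIV. norm (x $ i))"
proof -
  have P0: "0 \<le> P $ i $ j" and P1: "(\<Sum>j\<in>UNIV. P $ i $ j) = 1" for i j
    using P by (auto simp: stochastic_matrix_def)
  have c0: "0 \<le> c" using c norm_ge_zero order_trans by blast
  have "(\<Sum>j\<in>UNIV. norm ((H_mat P lam FS s *v x) $ j)) \<le> (\<Sum>j\<in>UNIV. c * (\<Sum>i\<in>UNIV. P $ i $ j * norm (x $ i)))"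
    unfolding H_mat_mult_vec norm_mult
  proof (intro sum_mono mult_mono c c0 norm_ge_zero)
    fix j
    show "norm (\<Sum>i\<in>UNIV. complex_of_real (P $ i $ j) * (LST (FS i) s * x $ i)) \<le> (\<Sum>i\<in>UNIV. P $ i $ j * norm (x $ i))"
      by (rule order_trans[OF norm_sum])
         (auto intro!: sum_mono mult_left_mono mult_left_le_one_le lst simp: norm_mult P0)
  qed
  also have "\<dots> = c * (\<Sum>i\<in>UNIV. \<Sum>j\<in>UNIV. P $ i $ j * norm (x $ i))"
    by (subst sum.swap) (simp add: sum_distrib_left)
  also have "\<dots> = c * (\<Sum>i\<in>UNIV. norm (x $ i))"
    by (simp add: sum_distrib_right[symmetric] P1)
  finally show ?thesis .
qed

text \<open>Matrices with \<open>l\<^sup>1\<close> norms at most \<open>exp (e n)\<close> have products of norm at most the exponential of the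
sum; the factor \<open>CARD('n)\<close> pays for passing between the \<open>l\<^sup>1\<close> and the Euclidean norm.\<close>
lemma norm_mat_prod_le:
  fixes Q :: "nat \<Rightarrow> complex^'n^'n"
  assumes step: "\<And>n x. (\<Sum>j\<in>UNIV. norm ((Q n *v x) $ j)) \<le> exp (e n) * (\<Sum>i\<in>UNIV. norm (x $ i))"
    and e: "summable e" "\<And>n. 0 \<le> e n"
  shows "norm (mat_prod Q n *v x) \<le> exp (suminf e) * real CARD('n) * norm x"
proof -
  have *: "(\<Sum>j\<in>UNIV. norm ((mat_prod Q n *v x) $ j)) \<le> exp (\<Sum>k<n. e k) * (\<Sum>i\<in>UNIV. norm (x $ i))" for x
  proof (induction n arbitrary: x)
    case (Suc n)
    have "(\<Sum>j\<in>UNIV. norm ((mat_prod Q (Suc n) *v x) $ j)) \<le> exp (\<Sum>k<n. e k) * (\<Sum>i\<in>UNIV. norm ((Q n *v x) $ i))"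
      using Suc[of "Q n *v x"] by (simp add: matrix_vector_mul_assoc)
    also have "\<dots> \<le> exp (\<Sum>k<n. e k) * (exp (e n) * (\<Sum>i\<in>UNIV. norm (x $ i)))"
      by (intro mult_left_mono step) simp
    finally show ?case by (simp add: exp_add mult_ac)
  qed simp
  have "norm (mat_prod Q n *v x) \<le> (\<Sum>j\<in>UNIV. norm ((mat_prod Q n *v x) $ j))"
    unfolding norm_vec_def by (rule L2_set_le_sum) simp
  also note *
  also have "exp (\<Sum>k<n. e k) * (\<Sum>i\<in>UNIV. norm (x $ i)) \<le> exp (suminf e) * (real CARD('n) * norm x)"
    using sum_le_suminf[OF e(1), of "{..<n}"] e(2)
    by (intro mult_mono sum_bounded_above[where A=UNIV, simplified]) (auto intro: sum_nonneg Finite_Cartesian_Product.norm_nth_le)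
  finally show ?thesis by (simp add: mult.assoc)
qed

text \<open>The points \<open>a\<^sup>n s\<close> avoid the positive numbers \<open>lam j\<close> and accumulate only at \<open>0\<close>, so their distance
to them is bounded away from zero. Equivalently, the inverses of the differences converge and hence
are bounded.\<close>
lemma geometric_orbit_separated:
  fixes s :: complex and a :: real and lam :: "'n::finite \<Rightarrow> real"
  assumes a: "0 < a" "a < 1" and lam: "\<And>j. 0 < lam j"
    and ne: "\<And>n j. complex_of_real (a ^ n) * s \<noteq> complex_of_real (lam j)"
  obtains d where "0 < d" "\<And>n j. d \<le> norm (complex_of_real (lam j) - complex_of_real (a ^ n) * s)"
proof -
  have lim: "(\<lambda>n. complex_of_real (a ^ n) * s) \<longlonglongrightarrow> 0"
    using a tendsto_of_real[OF LIMSEQ_realpow_zero[of a], where 'a=complex]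
    by (intro tendsto_mult_left_zero) simp
  have "\<exists>d>0. \<forall>n. d \<le> norm (complex_of_real (lam j) - complex_of_real (a ^ n) * s)" for j
  proof -
    have "(\<lambda>n. inverse (complex_of_real (lam j) - complex_of_real (a ^ n) * s)) \<longlonglongrightarrow> inverse (complex_of_real (lam j) - 0)"
      using lim lam[of j] by (intro tendsto_intros) auto
    then have "Bseq (\<lambda>n. inverse (complex_of_real (lam j) - complex_of_real (a ^ n) * s))"
      by (intro convergent_imp_Bseq convergentI)
    then obtain K where K: "0 < K" "\<And>n. norm (inverse (complex_of_real (lam j) - complex_of_real (a ^ n) * s)) \<le> K"
      by (auto simp: Bseq_def)
    have "inverse K \<le> norm (complex_of_real (lam j) - complex_of_real (a ^ n) * s)" for n
    proof -
      let ?x = "norm (complex_of_real (lam j) - complex_of_real (a ^ n) * s)"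
      have "0 < ?x" using ne[of n j] by simp
      moreover have "inverse ?x \<le> K" using K(2)[of n] by (simp only: norm_inverse)
      ultimately show ?thesis using K(1) le_imp_inverse_le[of "inverse ?x" K] by simp
    qed
    then show ?thesis using K(1) by (intro exI[of _ "inverse K"]) auto
  qed
  then obtain d where d: "\<And>j. 0 < d j" "\<And>j n. d j \<le> norm (complex_of_real (lam j) - complex_of_real (a ^ n) * s)"
    by metis
  show thesis
  proof
    show "0 < Min (range d)" using d(1) by simp
    show "Min (range d) \<le> norm (complex_of_real (lam j) - complex_of_real (a ^ n) * s)" for n j
      using Min_le[of "range d" "d j"] order_trans[OF _ d(2)[of j n]] by auto
  qed
qed

section \<open>Solution of the functional equation\<close>

theorem theorem4:
  fixes M :: "'w measure" and M' :: "'v measure"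
    and a :: real
    and P :: "real^'n^'n" and \<pi> :: "real^'n"
    and lam :: "'n \<Rightarrow> real" and FS :: "'n \<Rightarrow> real \<Rightarrow> real"
    and Y :: "nat \<Rightarrow> 'w \<Rightarrow> 'n"
    and W A S :: "nat \<Rightarrow> 'w \<Rightarrow> real"
    and W_inf :: "'v \<Rightarrow> real" and Y_inf :: "'v \<Rightarrow> 'n"
    and Z :: "complex \<Rightarrow> complex^'n" and H F :: "complex \<Rightarrow> complex^'n^'n" and v :: "complex^'n"
  defines "Z \<equiv> Z_vec M W Y"
    and "H \<equiv> H_mat P lam FS"
    and "F \<equiv> F_mat lam"
    and "v \<equiv> v_vec P lam FS a Z"
  assumes "prob_space M"
    and "0 < a" and "a < 1"
    and "stochastic_matrix P" and "irreducible_matrix P" and "stationary_distribution P \<pi>"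
    and "markov_chain M P Y"
    and "\<And>j. 0 < lam j"
    and "\<And>i. distribution_function_nonneg (FS i)"
    and "\<And>n. W n \<in> borel_measurable M"
    and "\<And>n. A (Suc n) \<in> borel_measurable M"
    and "\<And>n. S n \<in> borel_measurable M"
    and "\<And>n \<omega>. \<omega> \<in> space M \<Longrightarrow> 0 \<le> W n \<omega>"
    and "\<And>n \<omega>. \<omega> \<in> space M \<Longrightarrow> 0 \<le> A (Suc n) \<omega>"
    and "\<And>n \<omega>. \<omega> \<in> space M \<Longrightarrow> 0 \<le> S n \<omega>"
    and "\<And>n \<omega>. \<omega> \<in> space M \<Longrightarrow> W (Suc n) \<omega> = max 0 (a * W n \<omega> + S n \<omega> - A (Suc n) \<omega>)"
    and "conditionally_independent_of_past M Y W A S"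
    and "conditional_triple_law M P lam FS Y A S"
    and "is_steady_state M W Y \<pi> M' W_inf Y_inf"
  shows "(\<forall>s. 0 \<le> Re s \<longrightarrow>
            (\<forall>n j. complex_of_real (a ^ n) * s \<noteq> complex_of_real (lam j)) \<longrightarrow>
            summable (\<lambda>n. complex_of_real (a ^ n) *s
              ((mat_prod (\<lambda>m. H (complex_of_real (a ^ m) * s)) n
                ** F (complex_of_real (a ^ n) * s)) *v v)) \<and>
            convergent (\<lambda>n. mat_prod (\<lambda>m. H (complex_of_real (a ^ m) * s)) (Suc n)
                *v complex_vec \<pi>) \<and>
            Z s = s *s (\<Sum>n. complex_of_real (a ^ n) *s
              ((mat_prod (\<lambda>m. H (complex_of_real (a ^ m) * s)) n
                ** F (complex_of_real (a ^ n) * s)) *v v))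
              + lim (\<lambda>n. mat_prod (\<lambda>m. H (complex_of_real (a ^ m) * s)) (Suc n)
                *v complex_vec \<pi>))
         \<and> Z 0 = complex_vec \<pi>"
proof -
  have a: "0 < a" "a < 1" and P: "stochastic_matrix P" and lam: "\<And>j. 0 < lam j"
    and FS: "\<And>i. distribution_function_nonneg (FS i)" by fact+
  have Y: "\<And>n. Y n \<in> measurable M (count_space UNIV)"
    using \<open>markov_chain M P Y\<close> by (auto simp: markov_chain_def)
  have M': "prob_space M'" and V: "W_inf \<in> borel_measurable M'" "Y_inf \<in> measurable M' (count_space UNIV)"
    and V0: "\<And>\<omega>. \<omega> \<in> space M' \<Longrightarrow> 0 \<le> W_inf \<omega>"
    and \<pi>: "\<And>i. measure M' {\<omega> \<in> space M'. Y_inf \<omega> = i} = \<pi> $ i"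
    and lim: "\<And>s i. 0 \<le> Re s \<Longrightarrow> (\<lambda>n. joint_transform M (W n) (Y n) s i) \<longlonglongrightarrow> joint_transform M' W_inf Y_inf s i"
    using \<open>is_steady_state M W Y \<pi> M' W_inf Y_inf\<close> by (auto simp: is_steady_state_def)
  have Z: "Z s $ i = joint_transform M' W_inf Y_inf s i" if "0 \<le> Re s" for s i
    using limI[OF lim[OF that]] by (simp add: Z_def Z_vec_def)
  have Z0: "Z 0 = complex_vec \<pi>"
    using joint_transform_0[OF M' V(2)] \<pi> by (simp add: vec_eq_iff Z complex_vec_def)
  have step: "Z s = s *s (F s *v v) + H s *v Z (a * s)"
    if "0 \<le> Re s" "\<And>j. s \<noteq> complex_of_real (lam j)" for s :: complex
    unfolding F_def v_def H_def
  proof (rule functional_equation[where T="\<lambda>n. joint_transform M (W n) (Y n)"])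
    show "(\<lambda>n. joint_transform M (W n) (Y n) s i) \<longlonglongrightarrow> Z s $ i" if "0 \<le> Re s" for s i
      using lim[OF that] by (simp add: Z that)
    show "joint_transform M (W (Suc n)) (Y (Suc n)) s j =
      (\<Sum>i\<in>UNIV. complex_of_real (P $ i $ j) *
        (lam j / (lam j - s) * LST (FS i) s * joint_transform M (W n) (Y n) (a * s) i
         - s / (lam j - s) * LST (FS i) (lam j) * joint_transform M (W n) (Y n) (complex_of_real (a * lam j)) i))"
      if "s \<noteq> complex_of_real (lam j)" for n j
      by (rule joint_transform_Suc[where A=A and S=S]) (use assms(5-) Y that \<open>0 \<le> Re s\<close> in auto)
  qed (use lam a that in auto)
  show ?thesis
  proof (intro conjI Z0 allI impI)
    fix s :: complex
    assume s: "0 \<le> Re s" and ne: "\<forall>n j. complex_of_real (a ^ n) * s \<noteq> complex_of_real (lam j)"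
    define Q where "Q m = H (complex_of_real (a ^ m) * s)" for m
    define b where "b n = complex_of_real (a ^ n) *s (F (complex_of_real (a ^ n) * s) *v v)" for n
    define z where "z n = Z (complex_of_real (a ^ n) * s)" for n
    have re: "0 \<le> Re (complex_of_real (a ^ n) * s)" for n
      using s a by simp
    obtain d where d: "0 < d" "\<And>n j. d \<le> norm (complex_of_real (lam j) - complex_of_real (a ^ n) * s)"
      using geometric_orbit_separated[of a lam s] a lam ne by blast
    have rec: "z n = s *s b n + Q n *v z (Suc n)" for n
      using step[OF re, of n] ne by (simp add: z_def b_def Q_def vector_smult_assoc mult_ac)
    \<comment> \<open>\<open>\<lambda>\<^sub>j / (\<lambda>\<^sub>j - u) = 1 + u / (\<lambda>\<^sub>j - u)\<close> with \<open>u = a\<^sup>n s\<close> exceeds \<open>1\<close> in modulus by at most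
      \<open>\<bar>s\<bar> a\<^sup>n / d\<close>, and \<open>1 + x \<le> exp x\<close> makes the product of such bounds the exponential of a geometric series.\<close>
    have "(\<Sum>j\<in>UNIV. norm ((Q n *v x) $ j)) \<le> exp (norm s / d * a ^ n) * (\<Sum>i\<in>UNIV. norm (x $ i))" for n x
      unfolding Q_def H_def
    proof (rule l1_norm_H_mat_le[OF P norm_LST_le_1[OF FS re]])
      fix j
      let ?u = "complex_of_real (a ^ n) * s"
      have nz: "complex_of_real (lam j) - ?u \<noteq> 0"
        using ne[rule_format, of n j] by (metis right_minus_eq)
      then have "complex_of_real (lam j) / (complex_of_real (lam j) - ?u) = 1 + ?u / (complex_of_real (lam j) - ?u)"
        by (simp add: field_simps)
      also have "norm \<dots> \<le> 1 + norm ?u / norm (complex_of_real (lam j) - ?u)"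
        by (rule order_trans[OF norm_triangle_ineq]) (simp add: norm_divide)
      also have "\<dots> \<le> 1 + norm ?u / d"
        using d(1) d(2)[of j n] by (intro add_left_mono divide_left_mono mult_pos_pos) auto
      also have "\<dots> = 1 + norm s / d * a ^ n"
        using a by (simp add: norm_mult norm_power)
      also have "\<dots> \<le> exp (norm s / d * a ^ n)" by (rule exp_ge_add_one_self)
      finally show "norm (complex_of_real (lam j) / (complex_of_real (lam j) - ?u)) \<le> exp (norm s / d * a ^ n)" .
    qed
    from norm_mat_prod_le[of Q "\<lambda>n. norm s / d * a ^ n", OF this]
    obtain K where K: "\<And>n x. norm (mat_prod Q n *v x) \<le> K * norm x"
      using a d by (auto intro: summable_mult summable_geometric)
    have "norm (b n) \<le> (\<Sum>j\<in>UNIV. norm (v $ j) / d) * a ^ n" for n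
    proof -
      have "norm (b n) \<le> (\<Sum>j\<in>UNIV. norm (b n $ j))"
        unfolding norm_vec_def by (rule L2_set_le_sum) simp
      also have "\<dots> \<le> (\<Sum>j\<in>UNIV. norm (v $ j) / d * a ^ n)"
      proof (rule sum_mono)
        fix j
        have "norm (v $ j) / norm (complex_of_real (lam j) - complex_of_real (a ^ n) * s) \<le> norm (v $ j) / d"
          using d(1) d(2)[of j n] by (intro divide_left_mono mult_pos_pos) auto
        from mult_left_mono[OF this, of "a ^ n"]
        show "norm (b n $ j) \<le> norm (v $ j) / d * a ^ n"
          using a by (simp add: b_def F_def F_mat_mult_vec[OF lam] norm_mult norm_divide norm_power mult.commute)
      qed
      finally show ?thesis by (simp add: sum_distrib_right)
    qed
    then have sb: "summable (\<lambda>n. norm (b n))"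
      using a by (intro summable_comparison_test'[where N=0, OF summable_mult[OF summable_geometric[of a]]]) auto
    have lin: "bounded_linear (\<lambda>x :: complex^'n. c *s x)" for c :: complex
      by (auto simp: linear_conv_bounded_linear[symmetric] linear_iff vec_eq_iff algebra_simps)
    have z: "z \<longlonglongrightarrow> complex_vec \<pi>"
    proof (rule vec_tendstoI)
      fix i
      have "(\<lambda>n. complex_of_real (a ^ n) * s) \<longlonglongrightarrow> 0"
        using a tendsto_of_real[OF LIMSEQ_realpow_zero[of a], where 'a=complex]
        by (intro tendsto_mult_left_zero) simp
      from joint_transform_tendsto[OF M' V V0 re this]
      show "(\<lambda>n. z n $ i) \<longlonglongrightarrow> complex_vec \<pi> $ i"
        unfolding Z0[symmetric] z_def Z[OF re] by (simp add: Z)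
    qed
    have terms: "complex_of_real (a ^ n) *s ((mat_prod Q n ** F (complex_of_real (a ^ n) * s)) *v v) = mat_prod Q n *v b n" for n
      by (simp add: b_def matrix_vector_mul_assoc[symmetric] vector_scalar_commute)
    have sQb: "summable (\<lambda>n. mat_prod Q n *v b n)"
      by (rule summable_comparison_test'[OF summable_mult[OF sb]]) (rule K)
    have "(\<lambda>n. mat_prod Q n *v complex_vec \<pi>) \<longlonglongrightarrow> z 0 - (\<Sum>n. mat_prod Q n *v (s *s b n))"
    proof (rule backward_recursion_limit[OF rec K _ z])
      show "summable (\<lambda>n. norm (s *s b n))"
        using summable_mult[OF sb, of "norm s"]
        by (simp add: norm_vec_def norm_mult L2_set_right_distrib)
    qed
    also have "(\<Sum>n. mat_prod Q n *v (s *s b n)) = s *s (\<Sum>n. mat_prod Q n *v b n)"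
      using bounded_linear.suminf[OF lin sQb] by (simp add: vector_scalar_commute)
    also have "z 0 = Z s" by (simp add: z_def)
    \<comment> \<open>The products in the statement contain at least one factor, hence the shift by one.\<close>
    finally have prods: "(\<lambda>n. mat_prod Q (Suc n) *v complex_vec \<pi>) \<longlonglongrightarrow> Z s - s *s (\<Sum>n. mat_prod Q n *v b n)"
      by (rule LIMSEQ_Suc)
    show "summable (\<lambda>n. complex_of_real (a ^ n) *s
              ((mat_prod (\<lambda>m. H (complex_of_real (a ^ m) * s)) n
                ** F (complex_of_real (a ^ n) * s)) *v v))"
      using sQb unfolding Q_def[symmetric] terms .
    show "convergent (\<lambda>n. mat_prod (\<lambda>m. H (complex_of_real (a ^ m) * s)) (Suc n) *v complex_vec \<pi>)"
      using prods unfolding Q_def[symmetric] by (rule convergentI)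
    show "Z s = s *s (\<Sum>n. complex_of_real (a ^ n) *s
              ((mat_prod (\<lambda>m. H (complex_of_real (a ^ m) * s)) n
                ** F (complex_of_real (a ^ n) * s)) *v v))
              + lim (\<lambda>n. mat_prod (\<lambda>m. H (complex_of_real (a ^ m) * s)) (Suc n)
                *v complex_vec \<pi>)"
      unfolding Q_def[symmetric] terms limI[OF prods] by simp
  qed
qed

end
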